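(* Fix $p>1$. For $\alpha>1$ and $H\in C_c^\infty((0,\infty)\times\mathbb R)$ let $$\mathcal D_{\alpha,p}[H]=\frac{4(p-1)}{p^2}\int|\nabla H|^2r^\alpha\,dr\,dz+\frac{(3-\alpha)(\alpha-1)}p\int H^2r^{\alpha-2}\,dr\,dz .$$ (i) If $1<\alpha\le3$, then $\mathcal D_{\alpha,p}[H]\ge\frac{4(p-1)}{p^2}\int|\nabla H|^2r^\alpha\,dr\,dz$ for all $H$, and the coefficient $\frac{4(p-1)}{p^2}$ is sharp. (ii) If $3<\alpha<2p+1$, then for all $H$ $$\mathcal D_{\alpha,p}[H]\ge c_{\alpha,p}\int|\nabla H|^2r^\alpha\,dr\,dz,\qquad c_{\alpha,p}=\frac{4(2p+1-\alpha)}{p^2(\alpha-1)},$$ and the constant $c_{\alpha,p}$ is sharp. (iii) If $\alpha=2p+1$, then $\mathcal D_{\alpha,p}[H]\ge0$ for all $H$, but there is no constant $c>0$ such that $\mathcal D_{2p+1,p}[H]\ge c\int|\nabla H|^2r^{2p+1}\,dr\,dz$ for all $H$. (iv) If $\alpha>2p+1$, the form $\mathcal D_{\alpha,p}$ is indefinite: there exists $H$ with $\mathcal D_{\alpha,p}[H]<0$. Therefore no exponent $\alpha>1$ can both cancel the radial-strain term in the weighted swirl-rate energy identity recalled in the context (i.e. satisfy $\alpha-(2p+1)=0$) and admit a constant $c>0$ with $\mathcal D_{\alpha,p}[H]\ge c\int|\nabla H|^2r^\alpha\,dr\,dz$ for all $H$.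
   Context: Integrals are over $(r,z)\in(0,\infty)\times\mathbb R$ and $\nabla=(\partial_r,\partial_z)$. A coefficient in a lower bound is ``sharp'' if it cannot be replaced by any larger constant valid for all $H\in C_c^\infty((0,\infty)\times\mathbb R)$. The weighted swirl-rate energy identity for smooth rapidly decaying axisymmetric Navier--Stokes solutions with viscosity $\nu>0$, with $F=u^\theta/r$, $U=u^r/r$ and $H=|F|^{p/2}$, is $$\frac1p\frac{d}{dt}\int|F|^pr^\alpha\,dr\,dz+\nu\,\mathcal D_{\alpha,p}[H]=\frac{\alpha-(2p+1)}p\int U|F|^pr^\alpha\,dr\,dz ,$$ whose right-hand side is the radial-strain term. *)

theory Defs
  imports "HOL-Analysis.Analysis"
begin

(* Intended for open S, where the Frechet derivative at a point of S depends on f only within S. *)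
primrec Ck_on :: "nat \<Rightarrow> 'a::euclidean_space set \<Rightarrow> ('a \<Rightarrow> real) \<Rightarrow> bool" where
  "Ck_on 0 S f \<longleftrightarrow> continuous_on S f"
| "Ck_on (Suc k) S f \<longleftrightarrow>
     (\<forall>x\<in>S. f differentiable (at x)) \<and>
     (\<forall>b\<in>Basis. Ck_on k S (\<lambda>x. frechet_derivative f (at x) b))"

definition smooth_on :: "'a::euclidean_space set \<Rightarrow> ('a \<Rightarrow> real) \<Rightarrow> bool" where
  "smooth_on S f \<longleftrightarrow> (\<forall>k. Ck_on k S f)"

(* Elements of C_c^infinity(S) are represented by their extension by zero to the whole space:
   requiring the closure of the nonvanishing set to lie in S forces f = 0 outside S. *)
definition test_functions :: "'a::euclidean_space set \<Rightarrow> ('a \<Rightarrow> real) set" where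
  "test_functions S =
     {f. smooth_on S f \<and> compact (closure {x. f x \<noteq> 0}) \<and> closure {x. f x \<noteq> 0} \<subseteq> S}"

(* Points are pairs (r, z). *)
definition half_plane :: "(real \<times> real) set" where
  "half_plane = {0<..} \<times> UNIV"

definition grad :: "(real \<times> real \<Rightarrow> real) \<Rightarrow> real \<times> real \<Rightarrow> real \<times> real" where
  "grad H x = (frechet_derivative H (at x) (1, 0), frechet_derivative H (at x) (0, 1))"

definition gradient_energy :: "real \<Rightarrow> (real \<times> real \<Rightarrow> real) \<Rightarrow> real" where
  "gradient_energy \<alpha> H = (LINT x:half_plane|lborel. (norm (grad H x))\<^sup>2 * fst x powr \<alpha>)"

definition dissipation :: "real \<Rightarrow> real \<Rightarrow> (real \<times> real \<Rightarrow> real) \<Rightarrow> real" where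
  "dissipation \<alpha> p H =
     4 * (p - 1) / p\<^sup>2 * gradient_energy \<alpha> H +
     (3 - \<alpha>) * (\<alpha> - 1) / p * (LINT x:half_plane|lborel. (H x)\<^sup>2 * fst x powr (\<alpha> - 2))"

definition gradient_bound :: "real \<Rightarrow> real \<Rightarrow> real \<Rightarrow> bool" where
  "gradient_bound \<alpha> p c \<longleftrightarrow>
     (\<forall>H\<in>test_functions half_plane. dissipation \<alpha> p H \<ge> c * gradient_energy \<alpha> H)"

definition sharp_gradient_bound :: "real \<Rightarrow> real \<Rightarrow> real \<Rightarrow> bool" where
  "sharp_gradient_bound \<alpha> p c \<longleftrightarrow> gradient_bound \<alpha> p c \<and> (\<forall>c'>c. \<not> gradient_bound \<alpha> p c')"

end

theory Submission
  imports Defs "HOL-Computational_Algebra.Polynomial"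
begin

text \<open>
  Write \<open>G\<close> for the gradient energy \<open>\<integral> |\<nabla>H|\<^sup>2 r\<^sup>\<alpha>\<close> and \<open>M\<close> for the weighted mass
  \<open>\<integral> H\<^sup>2 r\<^bsup>\<alpha>-2\<^esup>\<close>, so that the dissipation is \<open>A G + B M\<close> with \<open>A = 4(p-1)/p\<^sup>2\<close> and
  \<open>B = (3-\<alpha>)(\<alpha>-1)/p\<close>. Everything is decided by the values that the quotient \<open>G/M\<close> can take.
  The weighted Hardy inequality (\<open>weighted_Hardy_inequality\<close>) says that \<open>G \<ge> S M\<close> with
  \<open>S = ((\<alpha>-1)/2)\<^sup>2\<close>; conversely every \<open>\<kappa> > S\<close> is the quotient of some test function
  (\<open>Hardy_quotient_attains\<close>). A lower bound with coefficient \<open>c\<close> therefore forces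
  \<open>(A - c) \<kappa> + B \<ge> 0\<close> for all \<open>\<kappa> > S\<close>.

  For \<open>1 < \<alpha> \<le> 3\<close> the term \<open>B M\<close> is nonnegative, which gives the bound with \<open>c = A\<close>, and letting
  \<open>\<kappa>\<close> tend to infinity shows that no larger \<open>c\<close> works. For \<open>\<alpha> \<ge> 3\<close> it is nonpositive, the Hardy
  inequality gives the bound with \<open>c = A + B/S\<close>, and letting \<open>\<kappa>\<close> decrease to \<open>S\<close> shows that it is
  optimal. This coefficient equals \<open>4(2p+1-\<alpha>)/(p\<^sup>2(\<alpha>-1))\<close>; it vanishes at \<open>\<alpha> = 2p+1\<close> and is
  negative beyond, and the remaining claims read off its sign.

  The Hardy inequality comes from expanding a square and discarding an exact radial derivative.
  For the converse, put \<open>s = (\<alpha>-1)/2\<close> and take separated functions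
  \<open>H(r,z) = r\<^bsup>-s\<^esup> b(\<epsilon> ln r) b(lz)\<close> with a smooth bump \<open>b\<close>. The substitution \<open>t = \<epsilon> ln r\<close>
  turns the radial integrals into multiples of \<open>\<integral> b\<^sup>2\<close> and \<open>\<integral> b'\<^sup>2\<close>, and the quotient becomes
  \<open>S + \<epsilon>\<^sup>2 X + l\<^sup>2 Y\<close>, where \<open>X > 0\<close> depends on neither parameter and \<open>Y > 0\<close> depends on
  \<open>\<epsilon>\<close> only. So \<open>\<epsilon>\<close> can be chosen first to produce half of \<open>\<kappa> - S\<close>, and then \<open>l\<close> to produce the
  other half.
\<close>

section \<open>Differentiability classes on the real line\<close>

text \<open>
  On the real line the recursion over Frechet derivatives becomes the ordinary one over a single
  derivative, so smoothness can be proved by induction on the order over families of functions that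
  are closed under differentiation.
\<close>

lemma Ck_on_real_Suc:
  fixes f f' :: "real \<Rightarrow> real"
  assumes "\<And>x. (f has_real_derivative f' x) (at x)"
  shows "Ck_on (Suc k) UNIV f \<longleftrightarrow> Ck_on k UNIV f'"
proof -
  have "frechet_derivative f (at x) = (\<lambda>h. f' x * h)" for x
    using frechet_derivative_at[OF assms[THEN has_field_derivative_imp_has_derivative]] by simp
  moreover have "f differentiable (at x)" for x
    using assms has_field_derivative_imp_has_derivative differentiableI by blast
  ultimately show ?thesis by simp
qed

lemma Ck_on_Suc_real_derivative:
  fixes f :: "real \<Rightarrow> real"
  assumes "Ck_on (Suc k) UNIV f"
  obtains f' where "\<And>x. (f has_real_derivative f' x) (at x)" "Ck_on k UNIV f'"
proof
  show "(f has_real_derivative frechet_derivative f (at x) 1) (at x)" for x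
  proof (rule has_derivative_imp_has_field_derivative)
    show D: "(f has_derivative frechet_derivative f (at x)) (at x)"
      using assms frechet_derivative_works by auto
    show "h * frechet_derivative f (at x) 1 = frechet_derivative f (at x) h" for h
      using linear_scale[OF has_derivative_linear[OF D], of h 1] by simp
  qed
  show "Ck_on k UNIV (\<lambda>x. frechet_derivative f (at x) 1)"
    using assms by simp
qed

lemma Ck_on_Suc_imp: "Ck_on (Suc k) S f \<Longrightarrow> Ck_on k S f"
proof (induction k arbitrary: f)
  case 0
  then show ?case
    by (simp add: continuous_at_imp_continuous_on differentiable_imp_continuous_within)
next
  case (Suc k)
  show ?case
    using Suc.prems Suc.IH unfolding Ck_on.simps(2)[of "Suc k"] Ck_on.simps(2)[of k] by blast
qed

(* The unfolding into Frechet derivatives would hide the real-line rules above from the simplifier. *)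
declare Ck_on.simps(2) [simp del]

lemma Ck_on_Suc_differentiable: "Ck_on (Suc k) S f \<Longrightarrow> x \<in> S \<Longrightarrow> f differentiable (at x)"
  by (simp add: Ck_on.simps(2))

lemma Ck_on_Suc_partial: "Ck_on (Suc k) S f \<Longrightarrow> b \<in> Basis \<Longrightarrow> Ck_on k S (\<lambda>x. frechet_derivative f (at x) b)"
  by (simp add: Ck_on.simps(2))

lemma Ck_on_subset: "Ck_on k T f \<Longrightarrow> S \<subseteq> T \<Longrightarrow> Ck_on k S f"
proof (induction k arbitrary: f)
  case 0
  then show ?case using continuous_on_subset by auto
next
  case (Suc k)
  then show ?case unfolding Ck_on.simps(2) by blast
qed

lemma Ck_on_real_add:
  fixes f g :: "real \<Rightarrow> real"
  shows "Ck_on k UNIV f \<Longrightarrow> Ck_on k UNIV g \<Longrightarrow> Ck_on k UNIV (\<lambda>x. f x + g x)"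
proof (induction k arbitrary: f g)
  case 0
  then show ?case by (auto intro: continuous_on_add)
next
  case (Suc k)
  obtain f' where f': "\<And>x. (f has_real_derivative f' x) (at x)" "Ck_on k UNIV f'"
    using Ck_on_Suc_real_derivative[OF Suc.prems(1)] by blast
  obtain g' where g': "\<And>x. (g has_real_derivative g' x) (at x)" "Ck_on k UNIV g'"
    using Ck_on_Suc_real_derivative[OF Suc.prems(2)] by blast
  have "((\<lambda>x. f x + g x) has_real_derivative f' x + g' x) (at x)" for x
    using f'(1) g'(1) by (rule DERIV_add)
  from Ck_on_real_Suc[OF this] show ?case
    using Suc.IH[OF f'(2) g'(2)] by simp
qed

lemma Ck_on_real_mult:
  fixes f g :: "real \<Rightarrow> real"
  shows "Ck_on k UNIV f \<Longrightarrow> Ck_on k UNIV g \<Longrightarrow> Ck_on k UNIV (\<lambda>x. f x * g x)"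
proof (induction k arbitrary: f g)
  case 0
  then show ?case by (auto intro: continuous_on_mult)
next
  case (Suc k)
  obtain f' where f': "\<And>x. (f has_real_derivative f' x) (at x)" "Ck_on k UNIV f'"
    using Ck_on_Suc_real_derivative[OF Suc.prems(1)] by blast
  obtain g' where g': "\<And>x. (g has_real_derivative g' x) (at x)" "Ck_on k UNIV g'"
    using Ck_on_Suc_real_derivative[OF Suc.prems(2)] by blast
  have D: "((\<lambda>x. f x * g x) has_real_derivative f' x * g x + g' x * f x) (at x)" for x
    using f'(1) g'(1) by (rule DERIV_mult)
  have "Ck_on k UNIV (\<lambda>x. f' x * g x + g' x * f x)"
    by (intro Ck_on_real_add Suc.IH f'(2) g'(2) Ck_on_Suc_imp[OF Suc.prems(1)] Ck_on_Suc_imp[OF Suc.prems(2)])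
  then show ?case
    using Ck_on_real_Suc[OF D] by blast
qed

lemma Ck_on_real_const: "Ck_on k UNIV (\<lambda>x::real. c)"
proof (induction k arbitrary: c)
  case (Suc k)
  have "((\<lambda>x. c) has_real_derivative 0) (at x)" for x :: real
    by simp
  from Ck_on_real_Suc[OF this] Suc show ?case by simp
qed simp

lemma Ck_on_real_affine:
  fixes f :: "real \<Rightarrow> real"
  shows "Ck_on k UNIV f \<Longrightarrow> Ck_on k UNIV (\<lambda>x. f (a + c * x))"
proof (induction k arbitrary: f)
  case 0
  then have "continuous_on UNIV (\<lambda>x. f (a + c * x))"
    by (auto intro!: continuous_on_compose2[of UNIV f UNIV "\<lambda>x. a + c * x"] continuous_on_add continuous_on_mult_left)
  then show ?case by simp
next
  case (Suc k)
  obtain f' where f': "\<And>x. (f has_real_derivative f' x) (at x)" "Ck_on k UNIV f'"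
    using Ck_on_Suc_real_derivative[OF Suc.prems(1)] by blast
  have D: "((\<lambda>x. f (a + c * x)) has_real_derivative f' (a + c * x) * c) (at x)" for x
    by (rule DERIV_chain2[OF f'(1)]) (auto intro!: derivative_eq_intros)
  have "Ck_on k UNIV (\<lambda>x. f' (a + c * x) * c)"
    by (intro Ck_on_real_mult Ck_on_real_const Suc.IH f'(2))
  then show ?case
    using Ck_on_real_Suc[OF D] by blast
qed

lemma has_derivative_separated:
  fixes u v :: "real \<Rightarrow> real" and x :: "real \<times> real"
  assumes "(u has_real_derivative u') (at (fst x))" and "(v has_real_derivative v') (at (snd x))"
  shows "((\<lambda>x. u (fst x) * v (snd x)) has_derivative
    (\<lambda>h. u (fst x) * (v' * snd h) + u' * fst h * v (snd x))) (at x)"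
  by (intro has_derivative_mult
      has_derivative_compose[OF has_derivative_fst[OF has_derivative_ident] has_field_derivative_imp_has_derivative[OF assms(1)]]
      has_derivative_compose[OF has_derivative_snd[OF has_derivative_ident] has_field_derivative_imp_has_derivative[OF assms(2)]])

text \<open>
  Both partial derivatives of \<open>u(r) v(z)\<close> are again separated, so induction on the order reduces
  smoothness in the plane to smoothness of the two factors.
\<close>

lemma Ck_on_separated:
  fixes u v :: "real \<Rightarrow> real"
  shows "Ck_on k UNIV u \<Longrightarrow> Ck_on k UNIV v \<Longrightarrow> Ck_on k UNIV (\<lambda>x. u (fst x) * v (snd x))"
proof (induction k arbitrary: u v)
  case 0
  then have "continuous_on UNIV (\<lambda>x::real \<times> real. u (fst x) * v (snd x))"
    by (intro continuous_on_mult continuous_on_compose2[of UNIV u UNIV fst]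
        continuous_on_compose2[of UNIV v UNIV snd] continuous_on_fst continuous_on_snd continuous_on_id) auto
  then show ?case by simp
next
  case (Suc k)
  obtain u' where u': "\<And>x. (u has_real_derivative u' x) (at x)" "Ck_on k UNIV u'"
    using Ck_on_Suc_real_derivative[OF Suc.prems(1)] by blast
  obtain v' where v': "\<And>x. (v has_real_derivative v' x) (at x)" "Ck_on k UNIV v'"
    using Ck_on_Suc_real_derivative[OF Suc.prems(2)] by blast
  note D = has_derivative_separated[OF u'(1) v'(1)]
  have "Ck_on k UNIV (\<lambda>x. u (fst x) * v' (snd x))" "Ck_on k UNIV (\<lambda>x. u' (fst x) * v (snd x))"
    by (intro Suc.IH u'(2) v'(2) Ck_on_Suc_imp[OF Suc.prems(1)] Ck_on_Suc_imp[OF Suc.prems(2)])+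
  then show ?case
    unfolding Ck_on.simps(2)
    using D[THEN differentiableI] by (auto simp: frechet_derivative_at[OF D, symmetric] Basis_prod_def)
qed

section \<open>A smooth bump function\<close>

lemma derivative_zero_outside:
  assumes "\<And>x. (f has_real_derivative f' x) (at x)" and "closed S" and "\<And>x. x \<notin> S \<Longrightarrow> f x = 0" and "x \<notin> S"
  shows "f' x = 0"
proof -
  have "((\<lambda>_. 0) has_real_derivative f' x) (at x)"
    by (rule has_field_derivative_transform_within_open[OF assms(1), of "- S"])
      (use assms in auto)
  then show ?thesis using DERIV_const DERIV_unique by blast
qed

lemma tendsto_poly_exp_neg: "((\<lambda>y. poly P y * exp (- y)) \<longlongrightarrow> (0::real)) at_top"
proof -
  have "((\<lambda>y. \<Sum>i\<le>degree P. coeff P i * (y ^ i / exp y)) \<longlongrightarrow> (\<Sum>i\<le>degree P. coeff P i * 0)) at_top"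
    by (intro tendsto_sum tendsto_mult tendsto_const tendsto_power_div_exp_0)
  then show ?thesis
    by (simp add: poly_altdef exp_minus sum_distrib_right divide_inverse mult.assoc)
qed

text \<open>
  The factor \<open>P(1/x)\<close> is kept general because differentiating \<open>exp(-1/x)\<close> produces such factors:
  the family over all polynomials is closed under differentiation.
\<close>

definition flat_exp :: "real poly \<Rightarrow> real \<Rightarrow> real" where
  "flat_exp P x = (if x > 0 then poly P (inverse x) * exp (- inverse x) else 0)"

text \<open>
  With \<open>y = 1/x\<close> one has \<open>dy/dx = -y\<^sup>2\<close>, so \<open>P(y) exp(-y)\<close> has derivative
  \<open>y\<^sup>2 (P(y) - P'(y)) exp(-y)\<close>. At the origin the difference quotient from the right is
  \<open>y P(y) exp(-y)\<close>, which tends to zero as \<open>y\<close> grows.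
\<close>

lemma flat_exp_derivative:
  "(flat_exp P has_real_derivative flat_exp ([:0, 0, 1:] * (P - pderiv P)) x) (at x)"
proof (cases x "0::real" rule: linorder_cases)
  case less
  have "((\<lambda>_. 0) has_real_derivative 0) (at x)" by simp
  then have "(flat_exp P has_real_derivative 0) (at x)"
    by (rule has_field_derivative_transform_within_open[of _ _ _ "{..<0}"])
      (use less in \<open>auto simp: flat_exp_def\<close>)
  then show ?thesis using less by (simp add: flat_exp_def)
next
  case equal
  have R: "((\<lambda>h. flat_exp P h / h) \<longlongrightarrow> 0) (at_right 0)"
  proof -
    have "((\<lambda>h. poly (pCons 0 P) (inverse h) * exp (- inverse h)) \<longlongrightarrow> 0) (at_right (0::real))"
      by (rule filterlim_compose[OF tendsto_poly_exp_neg filterlim_inverse_at_top_right])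
    then show ?thesis
      by (rule Lim_transform_eventually)
        (auto simp: flat_exp_def eventually_at_filter field_simps)
  qed
  have L: "((\<lambda>h. flat_exp P h / h) \<longlongrightarrow> 0) (at_left 0)"
    by (rule Lim_transform_eventually[OF tendsto_const])
      (auto simp: flat_exp_def eventually_at_filter)
  have "((\<lambda>h. flat_exp P h / h) \<longlongrightarrow> 0) (at 0)"
    using L R by (simp add: filterlim_split_at)
  then show ?thesis
    using equal by (simp add: DERIV_def flat_exp_def)
next
  case greater
  have "((\<lambda>x. poly P (inverse x) * exp (- inverse x)) has_real_derivative
      poly ([:0, 0, 1:] * (P - pderiv P)) (inverse x) * exp (- inverse x)) (at x)"
    using greater
    by (auto intro!: derivative_eq_intros DERIV_chain2[OF poly_DERIV] simp: field_simps power2_eq_square)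
  then have "(flat_exp P has_real_derivative
      poly ([:0, 0, 1:] * (P - pderiv P)) (inverse x) * exp (- inverse x)) (at x)"
    by (rule has_field_derivative_transform_within_open[of _ _ _ "{0<..}"])
      (use greater in \<open>auto simp: flat_exp_def\<close>)
  then show ?thesis using greater by (simp only: flat_exp_def if_True)
qed

lemma flat_exp_smooth: "Ck_on k UNIV (flat_exp P)"
proof (induction k arbitrary: P)
  case 0
  show ?case
    using DERIV_isCont[OF flat_exp_derivative] by (simp add: continuous_at_imp_continuous_on)
next
  case (Suc k)
  then show ?case using Ck_on_real_Suc[OF flat_exp_derivative] by simp
qed

definition bump :: "real \<Rightarrow> real" where
  "bump x = flat_exp 1 x * flat_exp 1 (1 + - 1 * x)"

lemma bump_smooth: "Ck_on k UNIV bump"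
  unfolding bump_def by (intro Ck_on_real_mult Ck_on_real_affine flat_exp_smooth)

lemma bump_nonzero_iff: "bump x \<noteq> 0 \<longleftrightarrow> 0 < x \<and> x < 1"
  by (auto simp: bump_def flat_exp_def)

lemma bump_derivative:
  obtains b' where "\<And>t. (bump has_real_derivative b' t) (at t)" "continuous_on UNIV b'"
    "\<And>t. t \<notin> {0..1} \<Longrightarrow> b' t = 0"
proof -
  obtain b' where b': "\<And>t. (bump has_real_derivative b' t) (at t)" "Ck_on 0 UNIV b'"
    using Ck_on_Suc_real_derivative[OF bump_smooth] by blast
  have zero: "b' t = 0" if "t \<notin> {0..1}" for t
    using b'(1) closed_atLeastAtMost _ that
  proof (rule derivative_zero_outside)
    show "bump t = 0" if "t \<notin> {0..1}" for t
      using that bump_nonzero_iff[of t] by auto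
  qed
  have "continuous_on UNIV b'"
    using b'(2) by simp
  from b'(1) this zero show ?thesis by (rule that)
qed

section \<open>Lebesgue integrals of compactly supported functions\<close>

lemma integrable_compact_support:
  fixes f :: "'a::euclidean_space \<Rightarrow> real"
  assumes "compact K" "continuous_on K f" "\<And>x. x \<notin> K \<Longrightarrow> f x = 0"
  shows "integrable lborel f"
proof -
  have "(\<lambda>x. indicator K x *\<^sub>R f x) = f"
    using assms(3) by (auto simp: fun_eq_iff indicator_def)
  then show ?thesis using borel_integrable_compact[OF assms(1,2)] by simp
qed

text \<open>
  Continuity is asked for on an open set only: the weight \<open>r\<^sup>\<alpha>\<close> need not be continuous at \<open>r = 0\<close>.
\<close>

lemma integral_pos_of_continuous:
  fixes f :: "'a::euclidean_space \<Rightarrow> real"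
  assumes "integrable lborel f" "\<And>x. 0 \<le> f x" "open S" "continuous_on S f" "x \<in> S" "f x \<noteq> 0"
  shows "0 < integral\<^sup>L lborel f"
proof (rule ccontr)
  assume "\<not> 0 < integral\<^sup>L lborel f"
  moreover have "0 \<le> integral\<^sup>L lborel f"
    by (rule Bochner_Integration.integral_nonneg) (rule assms(2))
  ultimately have "integral\<^sup>L lborel f = 0"
    by linarith
  then have "AE y in lborel. f y = 0"
    using integral_nonneg_eq_0_iff_AE[OF assms(1)] assms(2) by simp
  then have "AE y in lborel. y \<in> - (S \<inter> f -` (- {0}))"
    by eventually_elim simp
  then have "AE y in lebesgue. y \<in> - (S \<inter> f -` (- {0}))"
    by (rule AE_completion)
  moreover have "closed (- (S \<inter> f -` (- {0})))"
    unfolding closed_def double_complement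
    by (rule continuous_open_preimage[OF assms(4,3)]) (simp add: open_Compl)
  ultimately have "x \<in> - (S \<inter> f -` (- {0}))"
    using mem_closed_if_AE_lebesgue by blast
  then show False using assms(5,6) by simp
qed

lemma integral_derivative_eq_0:
  fixes F f :: "real \<Rightarrow> real"
  assumes "a \<le> b" and "\<And>x. x \<in> {a..b} \<Longrightarrow> (F has_real_derivative f x) (at x)"
    and "continuous_on {a..b} f" and "\<And>x. x \<notin> {a..b} \<Longrightarrow> f x = 0" and "F a = 0" "F b = 0"
  shows "integral\<^sup>L lborel f = 0"
proof -
  have "(\<lambda>x. indicator {a..b} x *\<^sub>R f x) = f"
    using assms(4) by (auto simp: fun_eq_iff indicator_def)
  moreover have "(F has_vector_derivative f x) (at x within {a..b})" if "a \<le> x" "x \<le> b" for x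
    using assms(2)[of x] that has_real_derivative_iff_has_vector_derivative has_vector_derivative_at_within
    by (metis atLeastAtMost_iff)
  ultimately show ?thesis
    using integral_FTC_atLeastAtMost[OF assms(1) _ assms(3), of F] assms(5,6) by simp
qed

lemma separated_integral:
  fixes f g :: "real \<Rightarrow> real"
  assumes f: "integrable lborel f" and g: "integrable lborel g"
  shows "integrable lborel (\<lambda>x. f (fst x) * g (snd x))"
    and "integral\<^sup>L lborel (\<lambda>x. f (fst x) * g (snd x)) = integral\<^sup>L lborel f * integral\<^sup>L lborel g"
proof -
  have [measurable]: "f \<in> borel_measurable borel" "g \<in> borel_measurable borel"
    using f g by auto
  have I: "integrable (lborel \<Otimes>\<^sub>M lborel) (\<lambda>x. f (fst x) * g (snd x))"
    by (rule lborel_pair.Fubini_integrable) (use f g in \<open>auto simp: abs_mult\<close>)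
  then show "integrable lborel (\<lambda>x. f (fst x) * g (snd x))"
    by (simp add: lborel_prod)
  show "integral\<^sup>L lborel (\<lambda>x. f (fst x) * g (snd x)) = integral\<^sup>L lborel f * integral\<^sup>L lborel g"
    using lborel_pair.integral_fst'[OF I] by (simp add: lborel_prod)
qed

text \<open>
  In the last claim the cross term is a multiple of \<open>\<integral> 2 b b'\<close>, the integral of the derivative of
  \<open>b\<^sup>2\<close>, which vanishes. This orthogonality is why the radial energy of a profile splits into the
  Hardy part \<open>\<sigma>\<^sup>2 \<integral> b\<^sup>2\<close> and an excess that is quadratic in \<open>\<epsilon>\<close>.
\<close>

lemma bump_integrals:
  assumes b': "\<And>t. (bump has_real_derivative b' t) (at t)" "continuous_on UNIV b'"
    and b'0: "\<And>t. t \<notin> {0..1} \<Longrightarrow> b' t = 0"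
  shows "integrable lborel (\<lambda>t. (bump t)\<^sup>2)" and "integrable lborel (\<lambda>t. (b' t)\<^sup>2)"
    and "0 < (LBINT t. (bump t)\<^sup>2)" and "0 < (LBINT t. (b' t)\<^sup>2)"
    and "(LBINT t. (\<epsilon> * b' t - \<sigma> * bump t)\<^sup>2) = \<epsilon>\<^sup>2 * (LBINT t. (b' t)\<^sup>2) + \<sigma>\<^sup>2 * (LBINT t. (bump t)\<^sup>2)"
proof -
  have b0: "bump t = 0" if "t \<notin> {0..1}" for t
    using that bump_nonzero_iff[of t] by auto
  have bc: "continuous_on S bump" for S
    using bump_smooth[of 0] continuous_on_subset[of UNIV bump S] by simp
  have b'c: "continuous_on S b'" for S
    using b'(2) continuous_on_subset[of UNIV b' S] by simp
  have int: "integrable lborel f" if "continuous_on {0..1} f" "\<And>t. t \<notin> {0..1} \<Longrightarrow> f t = 0" for f :: "real \<Rightarrow> real"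
    using integrable_compact_support[OF compact_Icc that] by blast
  show i0: "integrable lborel (\<lambda>t. (bump t)\<^sup>2)"
    by (rule int) (simp_all add: b0 bc continuous_on_power)
  show i1: "integrable lborel (\<lambda>t. (b' t)\<^sup>2)"
    by (rule int) (simp_all add: b'0 b'c continuous_on_power)
  have i2: "integrable lborel (\<lambda>t. 2 * bump t * b' t)"
    by (rule int) (simp_all add: b'0 b'c bc continuous_on_mult)
  show "0 < (LBINT t. (bump t)\<^sup>2)"
    by (rule integral_pos_of_continuous[OF i0, of UNIV "1/2"])
      (auto simp: bc continuous_on_power bump_nonzero_iff)
  have "\<exists>t. b' t \<noteq> 0"
  proof (rule ccontr)
    assume "\<not> (\<exists>t. b' t \<noteq> 0)"
    then have "bump (1/2) = bump 0"
      using DERIV_isconst_all[of bump] b'(1) by metis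
    then show False
      using bump_nonzero_iff[of "1/2"] bump_nonzero_iff[of 0] by auto
  qed
  then obtain t where "b' t \<noteq> 0" by blast
  then show "0 < (LBINT t. (b' t)\<^sup>2)"
    by (intro integral_pos_of_continuous[OF i1, of UNIV t]) (auto simp: b'c continuous_on_power)
  have i3: "(LBINT t. 2 * bump t * b' t) = 0"
  proof (rule integral_derivative_eq_0[of 0 1 "\<lambda>t. (bump t)\<^sup>2"])
    show "((\<lambda>t. (bump t)\<^sup>2) has_real_derivative 2 * bump t * b' t) (at t)" for t
      using DERIV_power[OF b'(1), where n = 2] by (simp add: mult_ac)
    show "(bump 0)\<^sup>2 = 0" "(bump 1)\<^sup>2 = 0"
      using bump_nonzero_iff[of 0] bump_nonzero_iff[of 1] by auto
  qed (simp_all add: b'0 b'c bc continuous_on_mult)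
  have "(LBINT t. (\<epsilon> * b' t - \<sigma> * bump t)\<^sup>2) =
      (LBINT t. \<epsilon>\<^sup>2 * (b' t)\<^sup>2 + \<sigma>\<^sup>2 * (bump t)\<^sup>2 - \<epsilon> * \<sigma> * (2 * bump t * b' t))"
    by (rule Bochner_Integration.integral_cong) (simp_all add: power2_eq_square algebra_simps)
  also have "\<dots> = \<epsilon>\<^sup>2 * (LBINT t. (b' t)\<^sup>2) + \<sigma>\<^sup>2 * (LBINT t. (bump t)\<^sup>2) - \<epsilon> * \<sigma> * (LBINT t. 2 * bump t * b' t)"
    by (simp only: Bochner_Integration.integral_diff Bochner_Integration.integral_add integral_mult_right_zero
        integrable_mult_right Bochner_Integration.integrable_add i0 i1 i2)
  finally show "(LBINT t. (\<epsilon> * b' t - \<sigma> * bump t)\<^sup>2) = \<epsilon>\<^sup>2 * (LBINT t. (b' t)\<^sup>2) + \<sigma>\<^sup>2 * (LBINT t. (bump t)\<^sup>2)"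
    by (simp only: i3)
qed

section \<open>Near-extremal radial profiles\<close>

text \<open>
  The power \<open>r\<^bsup>-\<sigma>\<^esup>\<close> with \<open>\<sigma> = (\<alpha>-1)/2\<close> is the formal extremal of the radial Hardy inequality;
  its mass diverges logarithmically at both ends, so it is cut off in the variable \<open>ln r\<close>.
\<close>

definition log_profile :: "real \<Rightarrow> real \<Rightarrow> (real \<Rightarrow> real) \<Rightarrow> real \<Rightarrow> real" where
  "log_profile \<sigma> \<epsilon> g r = (if r > 0 then r powr - \<sigma> * g (\<epsilon> * ln r) else 0)"

lemma log_profile_eq_0:
  assumes "\<epsilon> > 0" "\<And>t. t \<notin> {0..1} \<Longrightarrow> g t = 0" "r \<notin> {1..exp (1 / \<epsilon>)}"
  shows "log_profile \<sigma> \<epsilon> g r = 0"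
proof (cases "r > 0")
  case True
  have "\<epsilon> * ln r \<notin> {0..1}"
  proof
    assume "\<epsilon> * ln r \<in> {0..1}"
    then have "0 \<le> ln r" "ln r \<le> 1 / \<epsilon>"
      using assms(1) by (simp_all add: zero_le_mult_iff pos_le_divide_eq mult.commute)
    then have "exp 0 \<le> exp (ln r)" "exp (ln r) \<le> exp (1 / \<epsilon>)"
      by (simp_all only: exp_le_cancel_iff)
    then have "1 \<le> r" "r \<le> exp (1 / \<epsilon>)"
      using True by simp_all
    then show False using assms(3) by auto
  qed
  then show ?thesis using assms(2) by (simp add: log_profile_def)
qed (simp add: log_profile_def)

text \<open>
  Differentiation stays within the family, raising \<open>\<sigma>\<close> by one; this gives smoothness by induction
  and lets one integral formula serve both the profile and its derivative.
\<close>

lemma log_profile_derivative: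
  assumes "\<epsilon> > 0" and g': "\<And>t. (g has_real_derivative g' t) (at t)" and g0: "\<And>t. t \<notin> {0..1} \<Longrightarrow> g t = 0"
  shows "(log_profile \<sigma> \<epsilon> g has_real_derivative log_profile (\<sigma> + 1) \<epsilon> (\<lambda>t. \<epsilon> * g' t - \<sigma> * g t) r) (at r)"
proof (cases "r > 0")
  case True
  have "((\<lambda>r. r powr - \<sigma> * g (\<epsilon> * ln r)) has_real_derivative
      (- \<sigma> * r powr (- \<sigma> - 1)) * g (\<epsilon> * ln r) + (g' (\<epsilon> * ln r) * (\<epsilon> * (1 / r))) * r powr - \<sigma>) (at r)"
    by (rule DERIV_mult[OF has_real_derivative_powr[OF True] DERIV_chain2[OF g' DERIV_cmult[OF DERIV_ln_divide[OF True]]]])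
  moreover have "(- \<sigma> * r powr (- \<sigma> - 1)) * g (\<epsilon> * ln r) + (g' (\<epsilon> * ln r) * (\<epsilon> * (1 / r))) * r powr - \<sigma>
      = r powr (- (\<sigma> + 1)) * (\<epsilon> * g' (\<epsilon> * ln r) - \<sigma> * g (\<epsilon> * ln r))"
  proof -
    have e1: "r powr - \<sigma> = r powr (- (\<sigma> + 1)) * r"
      using True powr_add[of r "- (\<sigma> + 1)" 1] by simp
    have e2: "- \<sigma> - 1 = - (\<sigma> + 1)"
      by simp
    show ?thesis
      unfolding e1 e2 using True by (simp add: right_diff_distrib del: minus_add_distrib)
  qed
  ultimately have "((\<lambda>r. r powr - \<sigma> * g (\<epsilon> * ln r)) has_real_derivative
      log_profile (\<sigma> + 1) \<epsilon> (\<lambda>t. \<epsilon> * g' t - \<sigma> * g t) r) (at r)"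
    using True by (simp only: log_profile_def if_True)
  then show ?thesis
    by (rule has_field_derivative_transform_within_open[of _ _ _ "{0<..}"])
      (use True in \<open>auto simp: log_profile_def\<close>)
next
  case False
  have zero: "log_profile \<sigma> \<epsilon> g x = 0" if "x < 1" for x
  proof (rule log_profile_eq_0[OF assms(1)])
    show "g t = 0" if "t \<notin> {0..1}" for t
      using that by (rule g0)
  qed (use that in simp)
  have "(log_profile \<sigma> \<epsilon> g has_real_derivative 0) (at r)"
    by (rule has_field_derivative_transform_within_open[OF DERIV_const open_lessThan[of 1]])
      (use False in \<open>simp_all add: zero\<close>)
  then show ?thesis using False by (simp add: log_profile_def)
qed

lemma log_profile_smooth:
  assumes "\<epsilon> > 0" and "Ck_on (Suc k) UNIV g" and "\<And>t. t \<notin> {0..1} \<Longrightarrow> g t = 0"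
  shows "Ck_on k UNIV (log_profile \<sigma> \<epsilon> g)"
  using assms(2,3)
proof (induction k arbitrary: \<sigma> g)
  case 0
  obtain g' where g': "\<And>x. (g has_real_derivative g' x) (at x)" "Ck_on 0 UNIV g'"
    using Ck_on_Suc_real_derivative[OF 0(1)] by blast
  show ?case
    using DERIV_isCont[OF log_profile_derivative[OF assms(1) g'(1) 0(2)]]
    by (simp add: continuous_at_imp_continuous_on)
next
  case (Suc k)
  obtain g' where g': "\<And>x. (g has_real_derivative g' x) (at x)" "Ck_on (Suc k) UNIV g'"
    using Ck_on_Suc_real_derivative[OF Suc.prems(1)] by blast
  have "Ck_on (Suc k) UNIV (\<lambda>t. \<epsilon> * g' t + (- \<sigma>) * g t)"
    by (intro Ck_on_real_add Ck_on_real_mult Ck_on_real_const g'(2) Ck_on_Suc_imp[OF Suc.prems(1)])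
  moreover have "\<epsilon> * g' t + (- \<sigma>) * g t = 0" if "t \<notin> {0..1}" for t
    using that derivative_zero_outside[OF g'(1) closed_atLeastAtMost Suc.prems(2)] Suc.prems(2) by simp
  ultimately have "Ck_on k UNIV (log_profile (\<sigma> + 1) \<epsilon> (\<lambda>t. \<epsilon> * g' t + (- \<sigma>) * g t))"
    by (rule Suc.IH)
  then show ?case
    using Ck_on_real_Suc[OF log_profile_derivative[OF assms(1) g'(1) Suc.prems(2)]] by simp
qed

text \<open>
  The weight \<open>r\<^bsup>2\<sigma>-1\<^esup>\<close> cancels the power in the profile up to \<open>1/r\<close>, and \<open>dr/r = dt/\<epsilon>\<close> under
  \<open>t = \<epsilon> ln r\<close>. For \<open>\<sigma> = (\<alpha>-1)/2\<close> this is the weight \<open>r\<^bsup>\<alpha>-2\<^esup>\<close> of the mass, and for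
  \<open>\<sigma> + 1\<close>, which belongs to the derivative, it is the weight \<open>r\<^sup>\<alpha>\<close> of the energy.
\<close>

lemma log_profile_integral:
  assumes \<epsilon>: "\<epsilon> > 0" and g: "continuous_on UNIV g" and g0: "\<And>t. t \<notin> {0..1} \<Longrightarrow> g t = 0"
  shows "integrable lborel (\<lambda>r. (log_profile \<sigma> \<epsilon> g r)\<^sup>2 * r powr \<tau>)"
    and "integral\<^sup>L lborel (\<lambda>r. (log_profile \<sigma> \<epsilon> g r)\<^sup>2 * r powr (2 * \<sigma> - 1)) = integral\<^sup>L lborel (\<lambda>t. (g t)\<^sup>2) / \<epsilon>"
proof -
  have zero: "log_profile \<sigma> \<epsilon> g r = 0" if "r \<notin> {1..exp (1 / \<epsilon>)}" for r
  proof (rule log_profile_eq_0[OF \<epsilon>])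
    show "g t = 0" if "t \<notin> {0..1}" for t
      using that by (rule g0)
  qed (rule that)
  let ?b = "exp (1 / \<epsilon>)"
  have cont: "continuous_on {1..?b} (\<lambda>r. (r powr - \<sigma> * g (\<epsilon> * ln r))\<^sup>2 * r powr \<tau>)" for \<tau>
    by (intro continuous_intros continuous_on_compose2[OF g]) auto
  have eq: "(r powr - \<sigma> * g (\<epsilon> * ln r))\<^sup>2 = (log_profile \<sigma> \<epsilon> g r)\<^sup>2" if "r \<in> {1..?b}" for r
    using that by (auto simp: log_profile_def)
  show "integrable lborel (\<lambda>r. (log_profile \<sigma> \<epsilon> g r)\<^sup>2 * r powr \<tau>)"
  proof (rule integrable_compact_support)
    show "compact {1..?b}" by simp
    show "continuous_on {1..?b} (\<lambda>r. (log_profile \<sigma> \<epsilon> g r)\<^sup>2 * r powr \<tau>)"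
      using cont[of \<tau>] by (rule continuous_on_eq) (simp add: eq)
    show "(log_profile \<sigma> \<epsilon> g r)\<^sup>2 * r powr \<tau> = 0" if "r \<notin> {1..?b}" for r
      by (simp add: zero[OF that])
  qed
  have ind: "(g t)\<^sup>2 * indicator {\<epsilon> * ln 1..\<epsilon> * ln ?b} t = (g t)\<^sup>2" for t
    using g0[of t] \<epsilon> by (auto simp: indicator_def)
  have "integral\<^sup>L lborel (\<lambda>t. (g t)\<^sup>2) =
      (LBINT t. (g t)\<^sup>2 * indicator {\<epsilon> * ln 1..\<epsilon> * ln ?b} t)"
    by (simp only: ind)
  also have "\<dots> = (LBINT r. (g (\<epsilon> * ln r))\<^sup>2 * (\<epsilon> * (1 / r)) * indicator {1..?b} r)"
  proof (rule integral_substitution(2))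
    show "set_integrable lborel {\<epsilon> * ln 1..\<epsilon> * ln ?b} (\<lambda>t. (g t)\<^sup>2)"
      by (intro borel_integrable_atLeastAtMost' continuous_intros continuous_on_subset[OF g]) auto
    show "((\<lambda>r. \<epsilon> * ln r) has_real_derivative \<epsilon> * (1 / r)) (at r)" if "r \<in> {1..?b}" for r
      using that by (intro DERIV_cmult DERIV_ln_divide) auto
    show "continuous_on {1..?b} (\<lambda>r. \<epsilon> * (1 / r))"
      by (intro continuous_intros) auto
  qed (use \<epsilon> in auto)
  also have "\<dots> = (LBINT r. \<epsilon> * ((log_profile \<sigma> \<epsilon> g r)\<^sup>2 * r powr (2 * \<sigma> - 1)))"
  proof (rule Bochner_Integration.integral_cong[OF refl])
    fix r :: real
    show "(g (\<epsilon> * ln r))\<^sup>2 * (\<epsilon> * (1 / r)) * indicator {1..?b} r =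
        \<epsilon> * ((log_profile \<sigma> \<epsilon> g r)\<^sup>2 * r powr (2 * \<sigma> - 1))"
    proof (cases "r \<in> {1..?b}")
      case True
      then have "r > 0" by auto
      then have eq: "(r powr - \<sigma>)\<^sup>2 * r powr (2 * \<sigma> - 1) = 1 / r"
        using powr_add[of r "- \<sigma> + - \<sigma>" "2 * \<sigma> - 1"] powr_add[of r "- \<sigma>" "- \<sigma>"] powr_minus_divide[of r 1]
        by (simp add: power2_eq_square)
      have "\<epsilon> * ((log_profile \<sigma> \<epsilon> g r)\<^sup>2 * r powr (2 * \<sigma> - 1)) =
          \<epsilon> * (g (\<epsilon> * ln r))\<^sup>2 * ((r powr - \<sigma>)\<^sup>2 * r powr (2 * \<sigma> - 1))"
        using \<open>r > 0\<close> by (simp only: log_profile_def if_True power_mult_distrib mult_ac)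
      then show ?thesis
        using True by (simp add: eq)
    next
      case False
      then show ?thesis by (simp add: zero[OF False])
    qed
  qed
  finally show "integral\<^sup>L lborel (\<lambda>r. (log_profile \<sigma> \<epsilon> g r)\<^sup>2 * r powr (2 * \<sigma> - 1)) = integral\<^sup>L lborel (\<lambda>t. (g t)\<^sup>2) / \<epsilon>"
    using \<epsilon> by simp
qed

section \<open>The weighted Hardy inequality\<close>

lemma half_plane_iff: "x \<in> half_plane \<longleftrightarrow> 0 < fst x"
  by (cases x) (simp add: half_plane_def)

lemma half_plane_integral:
  assumes "\<And>x. fst x \<le> 0 \<Longrightarrow> f x = (0::real)"
  shows "(LINT x:half_plane|lborel. f x) = integral\<^sup>L lborel f"
proof -
  have "(\<lambda>x. indicator half_plane x *\<^sub>R f x) = f"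
    using assms by (auto simp: fun_eq_iff indicator_def half_plane_def)
  then show ?thesis by (simp add: set_lebesgue_integral_def)
qed

definition support :: "('a::topological_space \<Rightarrow> real) \<Rightarrow> 'a set" where
  "support H = closure {x. H x \<noteq> 0}"

lemma closed_support: "closed (support H)"
  by (simp add: support_def)

context
  fixes H :: "real \<times> real \<Rightarrow> real"
  assumes H: "H \<in> test_functions half_plane"
begin

lemma test_function_support:
  shows "compact (support H)" and "support H \<subseteq> half_plane"
  using H by (auto simp: test_functions_def support_def)

lemma test_function_eq_0: "x \<notin> support H \<Longrightarrow> H x = 0"
  unfolding support_def using closure_subset[of "{x. H x \<noteq> 0}"] by blast

lemma test_function_grad_eq_0:
  assumes "x \<notin> support H"
  shows "grad H x = 0"
proof -
  have "(H has_derivative (\<lambda>_. 0)) (at x)"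
    by (rule has_derivative_transform_within_open[OF has_derivative_const, of "- support H"])
      (use assms in \<open>auto simp: test_function_eq_0 closed_support open_Compl\<close>)
  from frechet_derivative_at[OF this, symmetric] show ?thesis
    by (simp add: grad_def zero_prod_def)
qed

lemma test_function_grad_continuous:
  shows "continuous_on half_plane H"
    and "continuous_on half_plane (\<lambda>x. fst (grad H x))" and "continuous_on half_plane (\<lambda>x. snd (grad H x))"
proof -
  have C: "Ck_on k half_plane H" for k
    using H by (simp add: test_functions_def smooth_on_def)
  show "continuous_on half_plane H"
    using C[of 0] by simp
  have "(1, 0) \<in> (Basis :: (real \<times> real) set)" "(0, 1) \<in> (Basis :: (real \<times> real) set)"
    by (simp_all add: Basis_prod_def)
  from this[THEN Ck_on_Suc_partial[OF C[of "Suc 0"]]]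
  show "continuous_on half_plane (\<lambda>x. fst (grad H x))" "continuous_on half_plane (\<lambda>x. snd (grad H x))"
    by (simp_all add: grad_def)
qed

lemma test_function_radial_derivative:
  assumes "r > 0"
  shows "((\<lambda>r. H (r, z)) has_real_derivative fst (grad H (r, z))) (at r)"
proof -
  let ?D = "frechet_derivative H (at (r, z))"
  have "Ck_on (Suc 0) half_plane H"
    using H by (simp only: test_functions_def smooth_on_def mem_Collect_eq)
  then have "H differentiable (at (r, z))"
    by (rule Ck_on_Suc_differentiable) (use assms in \<open>simp add: half_plane_iff\<close>)
  then have D: "(H has_derivative ?D) (at (r, z))"
    using frechet_derivative_works by blast
  have "((\<lambda>r. (r, z)) has_derivative (\<lambda>h. (h, 0))) (at r)"
    by (intro has_derivative_Pair has_derivative_ident has_derivative_const)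
  from has_derivative_compose[OF this D]
  have "((\<lambda>r. H (r, z)) has_derivative (\<lambda>h. ?D (h, 0))) (at r)" .
  moreover have "h * fst (grad H (r, z)) = ?D (h, 0)" for h
    using linear_scale[OF has_derivative_linear[OF D], of h "(1, 0)"] by (simp add: grad_def)
  ultimately show ?thesis
    by (rule has_derivative_imp_has_field_derivative)
qed

lemma test_function_integrable:
  assumes "continuous_on half_plane f" and "\<And>x. x \<notin> support H \<Longrightarrow> f x = 0"
  shows "integrable lborel (f :: _ \<Rightarrow> real)"
  using integrable_compact_support[OF test_function_support(1) continuous_on_subset[OF assms(1) test_function_support(2)]] assms(2)
  by blast

text \<open>
  The integrand is \<open>\<partial>\<^sub>r (H\<^sup>2 r\<^sup>\<beta>)\<close>, with the power \<open>r\<^bsup>\<beta>-1\<^esup>\<close> factored out, and \<open>H\<close> vanishes near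
  \<open>r = 0\<close> and for large \<open>r\<close>; so its integral over every horizontal line is zero.
\<close>

lemma radial_divergence_integral:
  shows "integrable lborel (\<lambda>x. (2 * H x * fst (grad H x) * fst x + \<beta> * (H x)\<^sup>2) * fst x powr (\<beta> - 1))"
      (is "integrable _ ?f")
    and "integral\<^sup>L lborel (\<lambda>x. (2 * H x * fst (grad H x) * fst x + \<beta> * (H x)\<^sup>2) * fst x powr (\<beta> - 1)) = 0"
proof -
  let ?K = "support H"
  note cont = test_function_grad_continuous
  have f: "continuous_on half_plane ?f"
    by (intro continuous_intros cont) (auto simp: half_plane_iff)
  show int: "integrable lborel ?f"
    by (rule test_function_integrable[OF f]) (simp add: test_function_eq_0)
  obtain a b :: real where ab: "0 < a" "a \<le> b" "fst ` ?K \<subseteq> {a<..<b}"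
  proof (cases "?K = {}")
    case False
    have c: "compact (fst ` ?K)" "fst ` ?K \<noteq> {}"
      using False test_function_support(1) by (auto intro!: compact_continuous_image continuous_intros)
    obtain m where m: "m \<in> fst ` ?K" "\<And>y. y \<in> fst ` ?K \<Longrightarrow> m \<le> y"
      using compact_attains_inf[OF c] by blast
    obtain n where n: "n \<in> fst ` ?K" "\<And>y. y \<in> fst ` ?K \<Longrightarrow> y \<le> n"
      using compact_attains_sup[OF c] by blast
    have "m > 0"
      using m(1) test_function_support(2) half_plane_iff by auto
    have "fst ` ?K \<subseteq> {m / 2<..<n + 1}"
    proof
      fix y assume "y \<in> fst ` ?K"
      from m(2)[OF this] n(2)[OF this] \<open>m > 0\<close> show "y \<in> {m / 2<..<n + 1}"
        by simp
    qed
    moreover have "m \<le> n" using m(2) n(1) by blast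
    ultimately show ?thesis
      using \<open>m > 0\<close> by (intro that[of "m / 2" "n + 1"]) auto
  qed (use that[of 1 2] in auto)
  have out: "(r, z) \<notin> ?K" if "r \<notin> {a<..<b}" for r z
    using ab(3) that by (metis fst_conv image_eqI subsetD)
  have "integral\<^sup>L lborel (\<lambda>r. ?f (r, z)) = 0" for z
  proof (rule integral_derivative_eq_0[of a b "\<lambda>r. (H (r, z))\<^sup>2 * r powr \<beta>"])
    fix r assume "r \<in> {a..b}"
    then have r: "r > 0" using ab by auto
    have "((\<lambda>r. (H (r, z))\<^sup>2) has_real_derivative 2 * H (r, z) * fst (grad H (r, z))) (at r)"
      using DERIV_power[OF test_function_radial_derivative[OF r], of z 2] by (simp add: mult_ac)
    from DERIV_mult[OF this has_real_derivative_powr[OF r]]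
    have "((\<lambda>r. (H (r, z))\<^sup>2 * r powr \<beta>) has_real_derivative
      2 * H (r, z) * fst (grad H (r, z)) * r powr \<beta> + \<beta> * r powr (\<beta> - 1) * (H (r, z))\<^sup>2) (at r)" .
    moreover have "r powr \<beta> = r powr (\<beta> - 1) * r"
      using r powr_add[of r "\<beta> - 1" 1] by simp
    ultimately show "((\<lambda>r. (H (r, z))\<^sup>2 * r powr \<beta>) has_real_derivative ?f (r, z)) (at r)"
      by (simp only: fst_conv) (simp add: algebra_simps)
  next
    show "continuous_on {a..b} (\<lambda>r. ?f (r, z))"
      by (rule continuous_on_compose2[OF f]) (use ab in \<open>auto intro!: continuous_intros simp: half_plane_iff\<close>)
    show "?f (r, z) = 0" if "r \<notin> {a..b}" for r
      using that test_function_eq_0[OF out[of r z]] by auto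
  qed (use ab test_function_eq_0[OF out[of _ z]] in auto)
  then show "integral\<^sup>L lborel ?f = 0"
    using lborel_pair.integral_snd[of "\<lambda>r z. ?f (r, z)"] int by (simp add: lborel_prod case_prod_unfold)
qed

end

definition weighted_mass :: "real \<Rightarrow> (real \<times> real \<Rightarrow> real) \<Rightarrow> real" where
  "weighted_mass \<alpha> H = (LINT x:half_plane|lborel. (H x)\<^sup>2 * fst x powr (\<alpha> - 2))"

lemma dissipation_eq:
  "dissipation \<alpha> p H = 4 * (p - 1) / p\<^sup>2 * gradient_energy \<alpha> H + (3 - \<alpha>) * (\<alpha> - 1) / p * weighted_mass \<alpha> H"
  by (simp add: dissipation_def weighted_mass_def)

lemma weighted_mass_nonneg: "0 \<le> weighted_mass \<alpha> H"
  unfolding weighted_mass_def set_lebesgue_integral_def by (rule Bochner_Integration.integral_nonneg) simp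

text \<open>
  With \<open>s = (\<alpha>-1)/2\<close>, expand \<open>0 \<le> (r \<partial>\<^sub>r H + s H)\<^sup>2 r\<^bsup>\<alpha>-2\<^esup>\<close>. The cross term
  \<open>2 s H \<partial>\<^sub>r H r\<^bsup>\<alpha>-1\<^esup>\<close> is \<open>s \<partial>\<^sub>r (H\<^sup>2 r\<^bsup>\<alpha>-1\<^esup>)\<close> minus \<open>2 s\<^sup>2 H\<^sup>2 r\<^bsup>\<alpha>-2\<^esup>\<close>; the exact derivative
  integrates to zero and the rest turns \<open>+s\<^sup>2\<close> into \<open>-s\<^sup>2\<close>. The \<open>z\<close>-derivative only helps.
\<close>

theorem weighted_Hardy_inequality:
  assumes H: "H \<in> test_functions half_plane"
  shows "((\<alpha> - 1) / 2)\<^sup>2 * weighted_mass \<alpha> H \<le> gradient_energy \<alpha> H"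
proof -
  define s where "s = (\<alpha> - 1) / 2"
  note cont = test_function_grad_continuous[OF H]
  note outside = test_function_eq_0[OF H] test_function_grad_eq_0[OF H]
  have out: "x \<notin> support H" if "fst x \<le> 0" for x
    using that test_function_support(2)[OF H] half_plane_iff[of x] by auto
  let ?M = "\<lambda>x. (H x)\<^sup>2 * fst x powr (\<alpha> - 2)"
  let ?G = "\<lambda>x. (norm (grad H x))\<^sup>2 * fst x powr \<alpha>"
  let ?d = "\<lambda>x. (2 * H x * fst (grad H x) * fst x + (\<alpha> - 1) * (H x)\<^sup>2) * fst x powr (\<alpha> - 1 - 1)"
  have norm: "(norm (grad H x))\<^sup>2 = (fst (grad H x))\<^sup>2 + (snd (grad H x))\<^sup>2" for x
    by (simp add: norm_prod_def)
  have M: "integrable lborel ?M"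
    by (rule test_function_integrable[OF H])
      (auto intro!: continuous_intros cont simp: half_plane_iff outside)
  have G: "integrable lborel ?G"
    unfolding norm by (rule test_function_integrable[OF H])
      (auto intro!: continuous_intros cont simp: half_plane_iff outside)
  note d = radial_divergence_integral[OF H, of "\<alpha> - 1"]
  have "s\<^sup>2 * ?M x \<le> ?G x + s * ?d x" for x
  proof (cases "fst x > 0")
    case True
    let ?w = "fst x powr (\<alpha> - 2)" and ?r = "fst x" and ?D = "fst (grad H x)"
    have G_powr: "?r powr \<alpha> = ?w * ?r\<^sup>2"
      using True powr_add[of ?r "\<alpha> - 2" 2] by simp
    have d_powr: "?r powr (\<alpha> - 1 - 1) = ?w"
      by simp
    have s: "\<alpha> - 1 = 2 * s"
      by (simp add: s_def)
    have square: "(D\<^sup>2 + q\<^sup>2) * (y * r\<^sup>2) + s * ((2 * h * D * r + 2 * s * h\<^sup>2) * y) - s\<^sup>2 * (h\<^sup>2 * y)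
        = ((r * D + s * h)\<^sup>2 + (r * q)\<^sup>2) * y" for D q y r h :: real
      by (simp add: power2_eq_square algebra_simps)
    have "?G x + s * ?d x - s\<^sup>2 * ?M x = ((?r * ?D + s * H x)\<^sup>2 + (?r * snd (grad H x))\<^sup>2) * ?w"
      unfolding norm G_powr d_powr unfolding s by (rule square)
    also have "\<dots> \<ge> 0" by simp
    finally show ?thesis by simp
  qed (simp add: outside out)
  then have "integral\<^sup>L lborel (\<lambda>x. s\<^sup>2 * ?M x) \<le> integral\<^sup>L lborel (\<lambda>x. ?G x + s * ?d x)"
    by (intro integral_mono Bochner_Integration.integrable_add integrable_mult_right M G d(1))
  also have "\<dots> = integral\<^sup>L lborel ?G + s * integral\<^sup>L lborel ?d"
    by (subst Bochner_Integration.integral_add) (use G d(1) in auto)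
  also have "\<dots> = integral\<^sup>L lborel ?G"
    by (simp only: d(2))
  finally show ?thesis
    unfolding weighted_mass_def gradient_energy_def s_def[symmetric]
    by (simp add: half_plane_integral outside out)
qed

section \<open>Every admissible Hardy quotient is attained\<close>

lemma separated_test_function:
  fixes u v :: "real \<Rightarrow> real"
  assumes "\<And>k. Ck_on k UNIV u" and "\<And>k. Ck_on k UNIV v"
    and u0: "\<And>r. r \<notin> {a..b} \<Longrightarrow> u r = 0" and "0 < a" and v0: "\<And>z. z \<notin> {c..d} \<Longrightarrow> v z = 0"
  shows "(\<lambda>x. u (fst x) * v (snd x)) \<in> test_functions half_plane"
proof -
  let ?H = "\<lambda>x. u (fst x) * v (snd x)"
  let ?K = "{a..b} \<times> {c..d}"
  have "Ck_on k half_plane ?H" for k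
    using Ck_on_separated[OF assms(1,2), of k] by (rule Ck_on_subset) simp
  moreover have K: "compact ?K"
    by (intro compact_Times compact_Icc)
  have sub: "closure {x. ?H x \<noteq> 0} \<subseteq> ?K"
  proof (rule closure_minimal)
    show "{x. ?H x \<noteq> 0} \<subseteq> ?K"
    proof
      fix x assume "x \<in> {x. ?H x \<noteq> 0}"
      then have "fst x \<in> {a..b}" "snd x \<in> {c..d}"
        using u0[of "fst x"] v0[of "snd x"] by auto
      then show "x \<in> ?K" by (simp only: mem_Times_iff)
    qed
    show "closed ?K" using K by (rule compact_imp_closed)
  qed
  moreover have "compact (closure {x. ?H x \<noteq> 0})"
    using bounded_subset[OF compact_imp_bounded[OF K] sub] by (simp add: compact_eq_bounded_closed)
  moreover have "?K \<subseteq> half_plane"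
    using \<open>0 < a\<close> by (auto simp: half_plane_iff)
  ultimately show ?thesis
    unfolding test_functions_def smooth_on_def by blast
qed

lemma separated_weighted_mass:
  assumes "integrable lborel (\<lambda>r. (u r)\<^sup>2 * r powr (\<alpha> - 2))" "integrable lborel (\<lambda>z. (v z)\<^sup>2)"
    and "\<And>r. r \<le> 0 \<Longrightarrow> u r = 0"
  shows "weighted_mass \<alpha> (\<lambda>x. u (fst x) * v (snd x)) =
    (LBINT r. (u r)\<^sup>2 * r powr (\<alpha> - 2)) * (LBINT z. (v z)\<^sup>2)"
proof -
  have eq: "(u (fst x) * v (snd x))\<^sup>2 * fst x powr (\<alpha> - 2) = ((u (fst x))\<^sup>2 * fst x powr (\<alpha> - 2)) * (v (snd x))\<^sup>2"
    for x :: "real \<times> real"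
    by (simp add: power_mult_distrib)
  have "weighted_mass \<alpha> (\<lambda>x. u (fst x) * v (snd x)) =
      integral\<^sup>L lborel (\<lambda>x. ((u (fst x))\<^sup>2 * fst x powr (\<alpha> - 2)) * (v (snd x))\<^sup>2)"
    unfolding weighted_mass_def eq by (rule half_plane_integral) (simp add: assms(3))
  then show ?thesis
    using separated_integral(2)[OF assms(1,2)] by simp
qed

lemma separated_gradient_energy:
  assumes u': "\<And>r. (u has_real_derivative u' r) (at r)" and v': "\<And>z. (v has_real_derivative v' z) (at z)"
    and int: "integrable lborel (\<lambda>r. (u r)\<^sup>2 * r powr \<alpha>)" "integrable lborel (\<lambda>z. (v z)\<^sup>2)"
      "integrable lborel (\<lambda>r. (u' r)\<^sup>2 * r powr \<alpha>)" "integrable lborel (\<lambda>z. (v' z)\<^sup>2)"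
    and zero: "\<And>r. r \<le> 0 \<Longrightarrow> u r = 0" "\<And>r. r \<le> 0 \<Longrightarrow> u' r = 0"
  shows "gradient_energy \<alpha> (\<lambda>x. u (fst x) * v (snd x)) =
    (LBINT r. (u' r)\<^sup>2 * r powr \<alpha>) * (LBINT z. (v z)\<^sup>2) + (LBINT r. (u r)\<^sup>2 * r powr \<alpha>) * (LBINT z. (v' z)\<^sup>2)"
proof -
  let ?P = "\<lambda>x::real \<times> real. ((u' (fst x))\<^sup>2 * fst x powr \<alpha>) * (v (snd x))\<^sup>2"
  let ?Q = "\<lambda>x::real \<times> real. ((u (fst x))\<^sup>2 * fst x powr \<alpha>) * (v' (snd x))\<^sup>2"
  have "grad (\<lambda>x. u (fst x) * v (snd x)) x = (u' (fst x) * v (snd x), u (fst x) * v' (snd x))" for x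
    unfolding grad_def frechet_derivative_at[OF has_derivative_separated[OF u' v'], symmetric] by simp
  then have eq: "(norm (grad (\<lambda>x. u (fst x) * v (snd x)) x))\<^sup>2 * fst x powr \<alpha> = ?P x + ?Q x" for x
    by (simp add: norm_prod_def power_mult_distrib distrib_left mult_ac)
  have "gradient_energy \<alpha> (\<lambda>x. u (fst x) * v (snd x)) = integral\<^sup>L lborel (\<lambda>x. ?P x + ?Q x)"
    unfolding gradient_energy_def eq by (rule half_plane_integral) (simp add: zero)
  also have "\<dots> = integral\<^sup>L lborel ?P + integral\<^sup>L lborel ?Q"
    by (rule Bochner_Integration.integral_add[OF separated_integral(1)[OF int(3,2)] separated_integral(1)[OF int(1,4)]])
  finally show ?thesis
    unfolding separated_integral(2)[OF int(3,2)] separated_integral(2)[OF int(1,4)] .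
qed

text \<open>
  The quotient of a near-extremal separated function exceeds \<open>((\<alpha>-1)/2)\<^sup>2\<close> by a radial excess
  proportional to \<open>\<epsilon>\<^sup>2\<close> and an axial excess proportional to \<open>l\<^sup>2\<close>. Since the axial factor depends on
  the profile and hence on \<open>\<epsilon>\<close>, the radial excess is fixed first; each is set to half of the gap.
\<close>

theorem Hardy_quotient_attains:
  assumes "\<kappa> > ((\<alpha> - 1) / 2)\<^sup>2"
  obtains H where "H \<in> test_functions half_plane" "0 < weighted_mass \<alpha> H"
    "gradient_energy \<alpha> H = \<kappa> * weighted_mass \<alpha> H"
proof -
  obtain b' where b': "\<And>t. (bump has_real_derivative b' t) (at t)" "continuous_on UNIV b'"
      "\<And>t. t \<notin> {0..1} \<Longrightarrow> b' t = 0"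
    using bump_derivative by blast
  note ints = bump_integrals[OF b']
  have b0: "bump t = 0" if "t \<notin> {0..1}" for t
    using that bump_nonzero_iff[of t] by auto
  have bc: "continuous_on UNIV bump"
    using bump_smooth[of 0] by simp
  define s where "s = (\<alpha> - 1) / 2"
  define B0 where "B0 = (LBINT t. (bump t)\<^sup>2)"
  define B1 where "B1 = (LBINT t. (b' t)\<^sup>2)"
  define \<delta> where "\<delta> = (\<kappa> - s\<^sup>2) / 2"
  have pos: "B0 > 0" "B1 > 0" "\<delta> > 0"
    using ints assms by (simp_all add: B0_def B1_def \<delta>_def s_def)
  (* The radial excess is \<epsilon>^2 * B1 / B0, made equal to \<delta>. *)
  define \<epsilon> where "\<epsilon> = sqrt (\<delta> * B0 / B1)"
  have \<epsilon>: "\<epsilon> > 0" "\<epsilon>\<^sup>2 * B1 = \<delta> * B0"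
    using pos by (simp_all add: \<epsilon>_def)
  define w where "w t = \<epsilon> * b' t - s * bump t" for t
  define u where "u = log_profile s \<epsilon> bump"
  define u' where "u' = log_profile (s + 1) \<epsilon> w"
  have wc: "continuous_on UNIV w"
    unfolding w_def by (intro continuous_intros bc b'(2))
  have w0: "w t = 0" if "t \<notin> {0..1}" for t
    using that b0 b'(3) by (simp add: w_def)
  have u0: "u r = 0" if "r \<notin> {1..exp (1 / \<epsilon>)}" for r
    unfolding u_def using \<epsilon>(1) b0 that by (rule log_profile_eq_0)
  have u'0: "u' r = 0" if "r \<notin> {1..exp (1 / \<epsilon>)}" for r
    unfolding u'_def using \<epsilon>(1) w0 that by (rule log_profile_eq_0)
  have du: "(u has_real_derivative u' r) (at r)" for r
    unfolding u_def u'_def w_def using \<epsilon>(1) b'(1) b0 by (rule log_profile_derivative)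
  have u_int: "integrable lborel (\<lambda>r. (u r)\<^sup>2 * r powr \<tau>)" for \<tau>
    unfolding u_def using \<epsilon>(1) bc b0 by (rule log_profile_integral(1))
  have u'_int: "integrable lborel (\<lambda>r. (u' r)\<^sup>2 * r powr \<tau>)" for \<tau>
    unfolding u'_def using \<epsilon>(1) wc w0 by (rule log_profile_integral(1))
  have mass_u: "(LBINT r. (u r)\<^sup>2 * r powr (\<alpha> - 2)) = B0 / \<epsilon>"
  proof -
    have "(LBINT r. (u r)\<^sup>2 * r powr (2 * s - 1)) = B0 / \<epsilon>"
      unfolding u_def B0_def using \<epsilon>(1) bc b0 by (rule log_profile_integral(2))
    moreover have "2 * s - 1 = \<alpha> - 2" by (simp add: s_def field_simps)
    ultimately show ?thesis by simp
  qed
  have energy_u: "(LBINT r. (u' r)\<^sup>2 * r powr \<alpha>) = (\<epsilon>\<^sup>2 * B1 + s\<^sup>2 * B0) / \<epsilon>"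
  proof -
    have "(LBINT r. (u' r)\<^sup>2 * r powr (2 * (s + 1) - 1)) = (LBINT t. (w t)\<^sup>2) / \<epsilon>"
      unfolding u'_def using \<epsilon>(1) wc w0 by (rule log_profile_integral(2))
    moreover have "2 * (s + 1) - 1 = \<alpha>" by (simp add: s_def field_simps)
    moreover have "(LBINT t. (w t)\<^sup>2) = \<epsilon>\<^sup>2 * B1 + s\<^sup>2 * B0"
      unfolding w_def B0_def B1_def by (rule ints(5))
    ultimately show ?thesis by simp
  qed
  define A where "A = (LBINT r. (u r)\<^sup>2 * r powr \<alpha>)"
  have "A > 0"
    unfolding A_def
  proof (rule integral_pos_of_continuous[OF u_int])
    show "continuous_on {0<..} (\<lambda>r. (u r)\<^sup>2 * r powr \<alpha>)"
      using du by (intro continuous_intros DERIV_continuous_on[of _ _ u']) (auto intro: DERIV_subset)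
    let ?r = "exp (1 / (2 * \<epsilon>))"
    show "(u ?r)\<^sup>2 * ?r powr \<alpha> \<noteq> 0"
      using \<epsilon>(1) bump_nonzero_iff[of "1/2"] by (simp add: u_def log_profile_def)
  qed auto
  (* The axial excess is l^2 * \<epsilon> * A * B1 / B0^2, also made equal to \<delta>. *)
  define l where "l = sqrt (\<delta> * B0\<^sup>2 / (\<epsilon> * A * B1))"
  have l: "l > 0" "l\<^sup>2 * (\<epsilon> * A * B1) = \<delta> * B0\<^sup>2"
    using pos \<epsilon>(1) \<open>A > 0\<close> by (simp_all add: l_def)
  define v where "v z = bump (0 + l * z)" for z
  define v' where "v' z = l * b' (0 + l * z)" for z
  have dv: "(v has_real_derivative v' z) (at z)" for z
    unfolding v_def v'_def
    by (rule DERIV_cong[OF DERIV_chain2[OF b'(1)]]) (auto intro!: derivative_eq_intros)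
  have v0: "v z = 0" if "z \<notin> {0..1 / l}" for z
    unfolding v_def
  proof (rule b0)
    show "0 + l * z \<notin> {0..1}"
      using that l(1) by (auto simp: zero_le_mult_iff pos_le_divide_eq mult.commute)
  qed
  have v_int: "integrable lborel (\<lambda>z. (v z)\<^sup>2)" and v'_int: "integrable lborel (\<lambda>z. (v' z)\<^sup>2)"
    using lborel_integrable_real_affine[OF ints(1), of l 0] lborel_integrable_real_affine[OF ints(2), of l 0] l(1)
    by (simp_all add: v_def v'_def power_mult_distrib)
  have scale: "(LBINT z. f (0 + l * z)) = (LBINT t. f t) / l" for f :: "real \<Rightarrow> real"
    using lborel_integral_real_affine[of l f 0] l(1) by simp
  have mass_v: "(LBINT z. (v z)\<^sup>2) = B0 / l"
    unfolding v_def B0_def by (rule scale)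
  have "(LBINT z. (v' z)\<^sup>2) = l\<^sup>2 * (LBINT z. (b' (0 + l * z))\<^sup>2)"
    unfolding v'_def power_mult_distrib by (rule integral_mult_right_zero)
  also have "\<dots> = l\<^sup>2 * (B1 / l)"
    unfolding B1_def scale[of "\<lambda>t. (b' t)\<^sup>2"] ..
  finally have energy_v: "(LBINT z. (v' z)\<^sup>2) = l * B1"
    using l(1) by (simp add: power2_eq_square)
  let ?H = "\<lambda>x. u (fst x) * v (snd x)"
  have "?H \<in> test_functions half_plane"
  proof (rule separated_test_function)
    show "Ck_on k UNIV u" for k
      unfolding u_def using \<epsilon>(1) bump_smooth b0 by (rule log_profile_smooth)
    show "Ck_on k UNIV v" for k
      unfolding v_def by (rule Ck_on_real_affine[OF bump_smooth])
    show "u r = 0" if "r \<notin> {1..exp (1 / \<epsilon>)}" for r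
      using that by (rule u0)
    show "v z = 0" if "z \<notin> {0..1 / l}" for z
      using that by (rule v0)
  qed simp
  moreover have M: "weighted_mass \<alpha> ?H = B0 / \<epsilon> * (B0 / l)"
    using separated_weighted_mass[OF u_int v_int] u0 mass_u mass_v by simp
  moreover have "gradient_energy \<alpha> ?H = (\<epsilon>\<^sup>2 * B1 + s\<^sup>2 * B0) / \<epsilon> * (B0 / l) + A * (l * B1)"
    using separated_gradient_energy[OF du dv u_int v_int u'_int v'_int] u0 u'0 energy_u mass_v energy_v
    by (simp add: A_def)
  moreover have "(\<epsilon>\<^sup>2 * B1 + s\<^sup>2 * B0) / \<epsilon> * (B0 / l) + A * (l * B1) = \<kappa> * (B0 / \<epsilon> * (B0 / l))"
  proof -
    have "A * (l * B1) = l\<^sup>2 * (\<epsilon> * A * B1) / (\<epsilon> * l)"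
      using \<epsilon>(1) l(1) by (simp add: power2_eq_square)
    also have "\<dots> = \<delta> * (B0 / \<epsilon> * (B0 / l))"
      unfolding l(2) by (simp add: power2_eq_square)
    finally have "(\<epsilon>\<^sup>2 * B1 + s\<^sup>2 * B0) / \<epsilon> * (B0 / l) + A * (l * B1) = (2 * \<delta> + s\<^sup>2) * (B0 / \<epsilon> * (B0 / l))"
      unfolding \<epsilon>(2) using \<epsilon>(1) l(1) by (simp add: field_simps)
    moreover have "2 * \<delta> + s\<^sup>2 = \<kappa>"
      by (simp add: \<delta>_def field_simps)
    ultimately show ?thesis by (simp only:)
  qed
  moreover have "0 < B0 / \<epsilon> * (B0 / l)"
    using pos \<epsilon>(1) l(1) by simp
  ultimately show ?thesis using that[of ?H] by simp
qed

section \<open>Sharp coefficients\<close>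

text \<open>
  Testing a bound on a function with Hardy quotient \<open>\<kappa>\<close> and dividing by its mass turns the bound
  into an affine inequality in \<open>\<kappa>\<close>.
\<close>

lemma gradient_bound_coefficient:
  assumes "gradient_bound \<alpha> p c" and "\<kappa> > ((\<alpha> - 1) / 2)\<^sup>2"
  shows "0 \<le> (4 * (p - 1) / p\<^sup>2 - c) * \<kappa> + (3 - \<alpha>) * (\<alpha> - 1) / p"
proof -
  obtain H where H: "H \<in> test_functions half_plane" "0 < weighted_mass \<alpha> H"
    "gradient_energy \<alpha> H = \<kappa> * weighted_mass \<alpha> H"
    using Hardy_quotient_attains[OF assms(2)] by blast
  have "c * gradient_energy \<alpha> H \<le> dissipation \<alpha> p H"
    using assms(1) H(1) by (simp add: gradient_bound_def)
  then have "0 \<le> ((4 * (p - 1) / p\<^sup>2 - c) * \<kappa> + (3 - \<alpha>) * (\<alpha> - 1) / p) * weighted_mass \<alpha> H"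
    unfolding dissipation_eq H(3) by (simp add: algebra_simps)
  then show ?thesis
    using H(2) by (simp add: zero_le_mult_iff)
qed

lemma dissipation_pos_exists:
  assumes "p > 1"
  shows "\<exists>H\<in>test_functions half_plane. dissipation \<alpha> p H > 0"
proof -
  define A where "A = 4 * (p - 1) / p\<^sup>2"
  define B where "B = (3 - \<alpha>) * (\<alpha> - 1) / p"
  (* Large enough for A * \<kappa> to outweigh B, whatever the sign of B. *)
  define \<kappa> where "\<kappa> = ((\<alpha> - 1) / 2)\<^sup>2 + 1 + \<bar>B\<bar> / A"
  have A: "A > 0"
    using assms by (simp add: A_def)
  have "\<kappa> > ((\<alpha> - 1) / 2)\<^sup>2"
    using A by (simp add: \<kappa>_def add_pos_nonneg)
  then obtain H where H: "H \<in> test_functions half_plane" "0 < weighted_mass \<alpha> H"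
    "gradient_energy \<alpha> H = \<kappa> * weighted_mass \<alpha> H"
    using Hardy_quotient_attains by blast
  have "A * \<kappa> = A * (((\<alpha> - 1) / 2)\<^sup>2 + 1) + \<bar>B\<bar>"
    using A by (simp add: \<kappa>_def distrib_left)
  moreover have "A * (((\<alpha> - 1) / 2)\<^sup>2 + 1) > 0"
    using A by (intro mult_pos_pos add_nonneg_pos) auto
  ultimately have "A * \<kappa> + B > 0"
    by linarith
  then have "(A * \<kappa> + B) * weighted_mass \<alpha> H > 0"
    using H(2) by simp
  also have "(A * \<kappa> + B) * weighted_mass \<alpha> H = dissipation \<alpha> p H"
    unfolding dissipation_eq H(3) A_def B_def by (simp add: distrib_right)
  finally show ?thesis using H(1) by blast
qed

text \<open>
  The zeroth-order term is nonnegative but negligible for functions with a large Hardy quotient, so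
  it cannot improve the coefficient.
\<close>

lemma sharp_gradient_bound_below_3:
  assumes "p > 1" "1 < \<alpha>" "\<alpha> \<le> 3"
  shows "sharp_gradient_bound \<alpha> p (4 * (p - 1) / p\<^sup>2)"
  unfolding sharp_gradient_bound_def
proof (intro conjI allI impI notI)
  define A where "A = 4 * (p - 1) / p\<^sup>2"
  define B where "B = (3 - \<alpha>) * (\<alpha> - 1) / p"
  have B: "B \<ge> 0"
    using assms by (simp add: B_def)
  show "gradient_bound \<alpha> p (4 * (p - 1) / p\<^sup>2)"
    unfolding gradient_bound_def dissipation_eq B_def[symmetric]
    using B weighted_mass_nonneg by simp
  fix c assume c: "4 * (p - 1) / p\<^sup>2 < c" and bound: "gradient_bound \<alpha> p c"
  (* Beyond B / (c - A) the affine function (A - c) * \<kappa> + B is negative. *)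
  define \<kappa> where "\<kappa> = ((\<alpha> - 1) / 2)\<^sup>2 + 1 + B / (c - A)"
  have cA: "c - A > 0"
    using c by (simp add: A_def)
  have "\<kappa> > ((\<alpha> - 1) / 2)\<^sup>2"
    using cA B by (simp add: \<kappa>_def add_pos_nonneg)
  from gradient_bound_coefficient[OF bound this]
  have "(c - A) * \<kappa> \<le> B"
    unfolding A_def B_def by (simp add: algebra_simps)
  moreover have "(c - A) * \<kappa> = (c - A) * (((\<alpha> - 1) / 2)\<^sup>2 + 1) + B"
    unfolding \<kappa>_def distrib_left[of _ _ "B / (c - A)"] using cA by simp
  moreover have "(c - A) * (((\<alpha> - 1) / 2)\<^sup>2 + 1) > 0"
    using cA by (intro mult_pos_pos add_nonneg_pos) auto
  ultimately show False by linarith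
qed

text \<open>
  Here the zeroth-order term is nonpositive, and the Hardy inequality bounds it by the gradient
  energy with the exact loss \<open>B/S\<close>; functions whose quotient is close to \<open>S\<close> lose almost that much.
  The coefficient may be zero or negative: its sharpness then gives the degenerate and the
  indefinite cases.
\<close>

lemma sharp_gradient_bound_above_3:
  assumes "p > 1" "3 \<le> \<alpha>"
  shows "sharp_gradient_bound \<alpha> p (4 * (2 * p + 1 - \<alpha>) / (p\<^sup>2 * (\<alpha> - 1)))"
proof -
  define C where "C = 4 * (2 * p + 1 - \<alpha>) / (p\<^sup>2 * (\<alpha> - 1))"
  define A where "A = 4 * (p - 1) / p\<^sup>2"
  define B where "B = (3 - \<alpha>) * (\<alpha> - 1) / p"
  define S where "S = ((\<alpha> - 1) / 2)\<^sup>2"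
  have S: "S > 0"
    using assms by (simp add: S_def)
  (* The claimed coefficient is exactly A + B / S. *)
  have threshold: "A * S + B = C * S"
  proof -
    define q where "q = \<alpha> - 1"
    have q: "q > 0" "\<alpha> = q + 1" using assms by (simp_all add: q_def)
    show ?thesis
      unfolding A_def B_def C_def S_def q(2) using q(1) assms(1)
      by (simp add: divide_simps power2_eq_square) (simp add: algebra_simps)
  qed
  have "B \<le> 0"
    using assms unfolding B_def by (intro divide_nonpos_pos mult_nonpos_nonneg) auto
  then have "C * S \<le> A * S"
    using threshold by linarith
  then have cA: "C \<le> A"
    using S by (simp only: mult_le_cancel_right_pos)
  have "gradient_bound \<alpha> p C"
    unfolding gradient_bound_def
  proof
    fix H assume "H \<in> test_functions half_plane"
    then have "S * weighted_mass \<alpha> H \<le> gradient_energy \<alpha> H"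
      unfolding S_def by (rule weighted_Hardy_inequality)
    then have "(A - C) * (S * weighted_mass \<alpha> H) \<le> (A - C) * gradient_energy \<alpha> H"
      using cA by (intro mult_left_mono) simp_all
    moreover have "(A - C) * (S * weighted_mass \<alpha> H) = - B * weighted_mass \<alpha> H"
    proof -
      have "(A - C) * S = - B"
        using threshold unfolding left_diff_distrib by linarith
      then show ?thesis by (simp only: mult.assoc[symmetric])
    qed
    ultimately show "C * gradient_energy \<alpha> H \<le> dissipation \<alpha> p H"
      unfolding dissipation_eq A_def[symmetric] B_def[symmetric] by (simp add: left_diff_distrib)
  qed
  moreover have "\<not> gradient_bound \<alpha> p c" if c: "C < c" for c
  proof
    assume bound: "gradient_bound \<alpha> p c"
    have ge: "0 \<le> (A - c) * \<kappa> + B" if "\<kappa> > S" for \<kappa>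
      using gradient_bound_coefficient[OF bound] that unfolding A_def B_def S_def by blast
    have "((\<lambda>\<kappa>. (A - c) * \<kappa> + B) \<longlongrightarrow> (A - c) * S + B) (at_right S)"
      by (intro tendsto_intros)
    then have "0 \<le> (A - c) * S + B"
      by (rule tendsto_lowerbound) (auto simp: eventually_at_filter ge)
    also have "(A - c) * S + B = (C - c) * S"
      using threshold unfolding left_diff_distrib by linarith
    also have "\<dots> < 0"
      using c S by (intro mult_neg_pos) simp_all
    finally show False by simp
  qed
  ultimately show ?thesis
    unfolding sharp_gradient_bound_def C_def by blast
qed

theorem theorem3p3:
  fixes p :: real
  assumes "p > 1"
  shows
    "(\<forall>\<alpha>::real. 1 < \<alpha> \<and> \<alpha> \<le> 3 \<longrightarrow>
        sharp_gradient_bound \<alpha> p (4 * (p - 1) / p\<^sup>2))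
   \<and> (\<forall>\<alpha>::real. 3 < \<alpha> \<and> \<alpha> < 2 * p + 1 \<longrightarrow>
        sharp_gradient_bound \<alpha> p (4 * (2 * p + 1 - \<alpha>) / (p\<^sup>2 * (\<alpha> - 1))))
   \<and> (\<forall>\<alpha>::real. \<alpha> = 2 * p + 1 \<longrightarrow>
        (\<forall>H\<in>test_functions half_plane. dissipation \<alpha> p H \<ge> 0)
        \<and> \<not> (\<exists>c>0. gradient_bound \<alpha> p c))
   \<and> (\<forall>\<alpha>::real. \<alpha> > 2 * p + 1 \<longrightarrow>
        (\<exists>H\<in>test_functions half_plane. dissipation \<alpha> p H < 0)
        \<and> (\<exists>H\<in>test_functions half_plane. dissipation \<alpha> p H > 0))
   \<and> \<not> (\<exists>\<alpha>::real. \<alpha> > 1 \<and> \<alpha> - (2 * p + 1) = 0 \<and> (\<exists>c>0. gradient_bound \<alpha> p c))"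
proof -
  have critical: "sharp_gradient_bound (2 * p + 1) p 0"
    using sharp_gradient_bound_above_3[of p "2 * p + 1"] assms by simp
  have negative: "\<exists>H\<in>test_functions half_plane. dissipation \<alpha> p H < 0" if "\<alpha> > 2 * p + 1" for \<alpha>
  proof -
    have "sharp_gradient_bound \<alpha> p (4 * (2 * p + 1 - \<alpha>) / (p\<^sup>2 * (\<alpha> - 1)))"
      by (rule sharp_gradient_bound_above_3) (use that assms in simp_all)
    moreover have "4 * (2 * p + 1 - \<alpha>) / (p\<^sup>2 * (\<alpha> - 1)) < 0"
      using that assms by (intro divide_neg_pos mult_pos_pos) simp_all
    ultimately have "\<not> gradient_bound \<alpha> p 0"
      unfolding sharp_gradient_bound_def by blast
    then show ?thesis
      unfolding gradient_bound_def by (auto simp: not_le)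
  qed
  show ?thesis
  proof (intro conjI allI impI)
    fix \<alpha> :: real
    show "sharp_gradient_bound \<alpha> p (4 * (p - 1) / p\<^sup>2)" if "1 < \<alpha> \<and> \<alpha> \<le> 3"
      using sharp_gradient_bound_below_3 assms that by blast
    show "sharp_gradient_bound \<alpha> p (4 * (2 * p + 1 - \<alpha>) / (p\<^sup>2 * (\<alpha> - 1)))" if "3 < \<alpha> \<and> \<alpha> < 2 * p + 1"
      using sharp_gradient_bound_above_3[OF assms, of \<alpha>] that by simp
    show "\<forall>H\<in>test_functions half_plane. dissipation \<alpha> p H \<ge> 0" if "\<alpha> = 2 * p + 1"
      using critical that by (simp add: sharp_gradient_bound_def gradient_bound_def)
    show "\<not> (\<exists>c>0. gradient_bound \<alpha> p c)" if "\<alpha> = 2 * p + 1"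
      using critical that by (auto simp: sharp_gradient_bound_def)
    show "\<exists>H\<in>test_functions half_plane. dissipation \<alpha> p H < 0" if "\<alpha> > 2 * p + 1"
      using negative[OF that] .
    show "\<exists>H\<in>test_functions half_plane. dissipation \<alpha> p H > 0" if "\<alpha> > 2 * p + 1"
      using dissipation_pos_exists[OF assms] .
  next
    show "\<not> (\<exists>\<alpha>::real. \<alpha> > 1 \<and> \<alpha> - (2 * p + 1) = 0 \<and> (\<exists>c>0. gradient_bound \<alpha> p c))"
    proof
      assume "\<exists>\<alpha>::real. \<alpha> > 1 \<and> \<alpha> - (2 * p + 1) = 0 \<and> (\<exists>c>0. gradient_bound \<alpha> p c)"
      then obtain \<alpha> c where "\<alpha> - (2 * p + 1) = 0" "c > 0" "gradient_bound \<alpha> p c" by blast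
      moreover from this(1) have "\<alpha> = 2 * p + 1" by simp
      ultimately show False
        using critical by (simp add: sharp_gradient_bound_def)
    qed
  qed
qed

end
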